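(* Suppose that $k$ is an even positive integer and write $k=2^jc$, where $c$ is odd and $j\geq 1$. Then $$2^{j+3}\ \Big|\ \operatorname{Num}\left(\frac{B_{2k}-B_k}{B_{2k}B_k}\right).$$
   Context: $B_k$ denotes the $k$-th Bernoulli number with the topologist's indexing and sign conventions: $B_k=(-1)^{k+1}\mathcal B_{2k}$ for $k\geq 1$, where $\frac{t}{e^t-1}=\sum_{n\geq 0}\mathcal B_n\frac{t^n}{n!}$. Thus $B_1=\frac16$, $B_2=\frac1{30}$, $B_3=\frac1{42}$, $B_4=\frac1{30}$, $B_5=\frac5{66}$, $B_6=\frac{691}{2730}$. For a rational number $\frac ab$, $\operatorname{Num}(\frac ab)$ is its numerator when expressed in lowest terms (with $\operatorname{Num}(0)=0$). *)

theory Defs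
  imports Complex_Main "HOL-Computational_Algebra.Formal_Power_Series"
begin

text \<open>The divisor has zero constant term, so this is the Euclidean division of formal power
  series; it is exact by \<open>bernoulli_fps_mult\<close> below.\<close>

definition bernoulli_fps :: "rat fps" where
  "bernoulli_fps = fps_X / (fps_exp 1 - 1)"

definition bernoulli :: "nat \<Rightarrow> rat" where
  "bernoulli n = fact n * fps_nth bernoulli_fps n"

text \<open>Topologist's indexing and signs; only meaningful for \<open>k \<ge> 1\<close>.\<close>

definition top_bernoulli :: "nat \<Rightarrow> rat" where
  "top_bernoulli k = (- 1) ^ (k + 1) * bernoulli (2 * k)"

text \<open>\<open>quotient_of\<close> yields the coprime representation with positive denominator, and
  \<open>(0, 1)\<close> for \<open>0\<close>.\<close>

definition Num :: "rat \<Rightarrow> int" where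
  "Num q = fst (quotient_of q)"

lemma bernoulli_fps_mult: "bernoulli_fps * (fps_exp 1 - 1) = fps_X"
proof -
  have nz: "fps_nth (fps_exp 1 - 1 :: rat fps) 1 \<noteq> 0"
    by simp
  have "subdegree (fps_exp 1 - 1 :: rat fps) = 1"
    by (rule subdegreeI) auto
  moreover have "(fps_exp 1 - 1 :: rat fps) \<noteq> 0"
    using nz by (metis fps_zero_nth)
  ultimately have "(fps_exp 1 - 1 :: rat fps) dvd fps_X"
    by (simp add: fps_dvd_iff)
  then show ?thesis
    by (simp add: bernoulli_fps_def)
qed

end

theory Submission
  imports Defs
begin

text \<open>Write \<open>b n\<close> for the \<open>n\<close>-th Bernoulli number. Multiplying \<open>t / (e^t - 1)\<close> by
  \<open>e^(2t) - 1 = (e^t - 1) (e^t + 1)\<close> gives, for \<open>n \<ge> 1\<close>,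
  \<open>b n + (\<Sum>i = 1..n. (n choose i) * b (n - i) * 2^i / (i + 1)) = 1/2\<close>.
  By induction every \<open>2 * b n\<close> is 2-integral. For even \<open>n \<ge> 4\<close> the \<open>i = 1\<close> term vanishes, and
  since \<open>(n choose i) = (n / i) * (n - 1 choose i - 1)\<close> the others are \<open>n\<close> times a 2-integral
  number. So \<open>b n\<close> is congruent to \<open>1/2\<close> modulo \<open>n\<close> 2-adically. Applied to \<open>n = 2k\<close> and
  \<open>n = 4k\<close>, this shows that \<open>2^(j+1)\<close> divides the difference of the two Bernoulli numbers,
  while their product is a quarter of a 2-adic unit.\<close>

section \<open>The local ring of rationals with odd denominator\<close>

definition two_integral :: "rat set" where
  "two_integral = {q. \<exists>a b::int. odd b \<and> q = of_int a / of_int b}"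

lemma two_integralI: "odd b \<Longrightarrow> of_int a / of_int b \<in> two_integral"
  unfolding two_integral_def by blast

lemma two_integralE:
  assumes "q \<in> two_integral"
  obtains a b :: int where "odd b" "b \<noteq> 0" "q = of_int a / of_int b"
proof -
  from assms obtain a b :: int where ab: "odd b" "q = of_int a / of_int b"
    unfolding two_integral_def by blast
  from ab(1) have "b \<noteq> 0" by auto
  with ab show thesis using that by blast
qed

lemma two_integral_of_int [simp]: "of_int a \<in> two_integral"
  using two_integralI[of 1 a] by simp

lemma two_integral_of_nat [simp]: "of_nat a \<in> two_integral"
  using two_integral_of_int[of "int a"] by simp

lemma two_integral_0 [simp]: "0 \<in> two_integral"
  and two_integral_1 [simp]: "1 \<in> two_integral"
  and two_integral_numeral [simp]: "numeral w \<in> two_integral"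
  using two_integral_of_int[of 0] two_integral_of_int[of 1] two_integral_of_int[of "numeral w"]
  by simp_all

lemma two_integral_add:
  assumes "p \<in> two_integral" "q \<in> two_integral"
  shows "p + q \<in> two_integral"
proof -
  obtain a b where ab: "odd b" "b \<noteq> 0" "p = of_int a / of_int b"
    using assms(1) by (rule two_integralE)
  obtain c d where cd: "odd d" "d \<noteq> 0" "q = of_int c / of_int d"
    using assms(2) by (rule two_integralE)
  have "p + q = of_int (a * d + c * b) / of_int (b * d)"
    using ab cd by (simp add: field_simps)
  moreover have "odd (b * d)" using ab cd by simp
  ultimately show ?thesis by (metis two_integralI)
qed

lemma two_integral_mult:
  assumes "p \<in> two_integral" "q \<in> two_integral"
  shows "p * q \<in> two_integral"
proof -
  obtain a b where ab: "odd b" "b \<noteq> 0" "p = of_int a / of_int b"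
    using assms(1) by (rule two_integralE)
  obtain c d where cd: "odd d" "d \<noteq> 0" "q = of_int c / of_int d"
    using assms(2) by (rule two_integralE)
  have "p * q = of_int (a * c) / of_int (b * d)"
    using ab cd by simp
  moreover have "odd (b * d)" using ab cd by simp
  ultimately show ?thesis by (metis two_integralI)
qed

lemma two_integral_minus: "p \<in> two_integral \<Longrightarrow> - p \<in> two_integral"
  using two_integral_mult[of "-1" p] two_integral_of_int[of "-1"] by simp

lemma two_integral_diff:
  "p \<in> two_integral \<Longrightarrow> q \<in> two_integral \<Longrightarrow> p - q \<in> two_integral"
  using two_integral_add[of p "- q"] two_integral_minus[of q] by simp

lemma two_integral_sum:
  "(\<And>i. i \<in> A \<Longrightarrow> f i \<in> two_integral) \<Longrightarrow> sum f A \<in> two_integral"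
  by (induction A rule: infinite_finite_induct) (auto intro: two_integral_add)

text \<open>Elements congruent to 1 modulo 2 are units: over the odd denominator \<open>b\<close>,
  the numerator \<open>b + 2 * a\<close> is odd again.\<close>

lemma two_integral_inverse_unit:
  assumes "u \<in> two_integral"
  shows "inverse (1 + 2 * u) \<in> two_integral"
proof -
  obtain a b where ab: "odd b" "b \<noteq> 0" "u = of_int a / of_int b"
    using assms by (rule two_integralE)
  have od: "odd (b + 2 * a)" using ab(1) by simp
  have eq: "1 + 2 * u = of_int (b + 2 * a) / of_int b"
    using ab by (simp add: field_simps)
  have "inverse (1 + 2 * u) = of_int b / of_int (b + 2 * a)"
    unfolding eq by (rule inverse_divide)
  then show ?thesis using two_integralI[OF od] by metis
qed

text \<open>The bound forces the power of 2 dividing \<open>m\<close> to be at most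
  \<open>2 ^ i\<close>, so it cancels and only the odd part of \<open>m\<close> remains as
  denominator.\<close>

lemma two_power_divide_two_integral:
  assumes "0 < m" and "m < 2 ^ Suc i"
  shows "2 ^ i / of_nat m \<in> two_integral"
proof -
  obtain r s where rs: "m = 2 ^ r * s" "odd s"
    using assms(1) multiplicity_decompose'[of m 2]
    by (metis neq0_conv nat_dvd_1_iff_1 numeral_eq_one_iff semiring_norm(85))
  have "s > 0" using rs(2) by (cases s) auto
  then have "(2::nat) ^ r \<le> m" using rs(1) by simp
  with assms(2) have "(2::nat) ^ r < 2 ^ Suc i" by linarith
  then have "r \<le> i" by (simp only: power_strict_increasing_iff less_Suc_eq_le)
  then have "(2::rat) ^ i = 2 ^ r * 2 ^ (i - r)" by (simp flip: power_add)
  then have "2 ^ i / of_nat m = of_int (2 ^ (i - r)) / (of_int (int s) :: rat)"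
    using rs(1) by simp
  then show ?thesis using two_integralI[of "int s" "2 ^ (i - r)"] rs(2) by simp
qed

text \<open>Cross-multiplying the reduced form \<open>p / d\<close> gives
  \<open>p * b = 2 ^ m * (a * d)\<close>, and the odd \<open>b\<close> cannot absorb any factor
  2.\<close>

lemma power_dvd_Num:
  assumes "z \<in> two_integral"
  shows "2 ^ m dvd Num (2 ^ m * z)"
proof -
  obtain a b where ab: "odd b" "b \<noteq> 0" "z = of_int a / of_int b"
    using assms by (rule two_integralE)
  obtain p d where pd: "quotient_of (2 ^ m * z) = (p, d)"
    by (cases "quotient_of (2 ^ m * z)")
  have "d \<noteq> 0" using quotient_of_denom_pos[OF pd] by simp
  have "(of_int p :: rat) / of_int d = 2 ^ m * (of_int a / of_int b)"
    using quotient_of_div[OF pd] ab(3) by simp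
  then have "(of_int (p * b) :: rat) = of_int (2 ^ m * (a * d))"
    using ab(2) \<open>d \<noteq> 0\<close> by (simp add: field_simps)
  then have "p * b = 2 ^ m * (a * d)" by (simp only: of_int_eq_iff)
  then have "2 ^ m dvd p * b" by simp
  moreover have "coprime (2 ^ m) b" using ab(1) by simp
  ultimately have "2 ^ m dvd p" by (simp add: coprime_dvd_mult_left_iff)
  then show ?thesis by (simp add: Num_def pd)
qed

section \<open>Bernoulli identities from the generating function\<close>

text \<open>With F(t) = t / (e^t - 1), one has F(-t) = F(t) + t, so odd coefficients other than that
  of t equal their own negatives.\<close>

lemma bernoulli_odd:
  assumes "odd n" and "n \<noteq> 1"
  shows "bernoulli n = 0"
proof -
  let ?E = "fps_exp 1 :: rat fps" and ?E' = "fps_exp (-1) :: rat fps"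
  define G where "G = bernoulli_fps oo (- fps_X)"
  have G_nth: "fps_nth G m = (- 1) ^ m * fps_nth bernoulli_fps m" for m
    by (simp add: G_def fps_compose_uminus')
  have E0: "?E - 1 \<noteq> 0"
    using bernoulli_fps_mult by auto
  have EE: "?E * ?E' = 1"
    using fps_exp_add_mult[of "1 :: rat" "-1"] by simp
  have cE: "?E oo (- fps_X) = ?E'"
    by simp
  have "(bernoulli_fps * (?E - 1)) oo (- fps_X) = fps_X oo (- fps_X :: rat fps)"
    by (simp only: bernoulli_fps_mult)
  then have "G * (?E' - 1) = - fps_X"
    by (simp add: G_def fps_compose_mult_distrib fps_compose_sub_distrib cE)
  \<comment> \<open>Multiplying by e^t clears e^(-t), so that \<open>?E - 1\<close> can be cancelled
    later.\<close>
  then have "G * (?E' - 1) * ?E = - fps_X * ?E"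
    by (rule arg_cong)
  moreover have "G * (?E' - 1) * ?E = G * (?E * ?E') - G * ?E"
    by (simp add: algebra_simps)
  ultimately have "G - G * ?E = - (fps_X * ?E)"
    by (simp only: EE mult_1_right mult_minus_left)
  then have "G * (?E - 1) = fps_X * ?E"
    by (simp add: algebra_simps)
  also have "\<dots> = (bernoulli_fps + fps_X) * (?E - 1)"
    by (simp only: distrib_right bernoulli_fps_mult) (simp add: algebra_simps)
  finally have "G = bernoulli_fps + fps_X"
    using E0 by simp
  then have "fps_nth G n = fps_nth bernoulli_fps n"
    using assms(2) by simp
  then show ?thesis
    using assms(1) by (simp add: G_nth bernoulli_def)
qed

lemma bernoulli_recurrence:
  assumes "n > 0"
  shows "bernoulli n + (\<Sum>i=1..n. of_nat (n choose i) * bernoulli (n - i) * 2 ^ i / of_nat (i + 1))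
    = 1 / 2"
proof -
  let ?E = "fps_exp 1 :: rat fps" and ?E2 = "fps_exp 2 :: rat fps"
  let ?F = bernoulli_fps
  have "?E * ?E = ?E2"
    using fps_exp_add_mult[of "1 :: rat" 1] by simp
  then have "(?E2 - 1) * ?F = (?F * (?E - 1)) * (?E + 1)"
    by (simp add: algebra_simps)
  also have "\<dots> = fps_X * (?E + 1)"
    by (simp only: bernoulli_fps_mult)
  finally have "fps_nth ((?E2 - 1) * ?F) (Suc n) = fps_nth (fps_X * (?E + 1)) (Suc n)"
    by (rule arg_cong)
  \<comment> \<open>For \<open>n = 0\<close> the constant term of \<open>?E + 1\<close> would give 2
    instead.\<close>
  also have "\<dots> = 1 / fact n"
    using assms by simp
  also have "fps_nth ((?E2 - 1) * ?F) (Suc n)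
      = (\<Sum>i=0..Suc n. fps_nth (?E2 - 1) i * fps_nth ?F (Suc n - i))"
    by (simp only: fps_mult_nth)
  \<comment> \<open>The term at 0 drops out because \<open>?E2 - 1\<close> has no constant term; the
    rest is shifted by one.\<close>
  also have "\<dots> = (\<Sum>i=0..n. 2 ^ Suc i / fact (Suc i) * fps_nth ?F (n - i))"
    by (subst sum.atLeast0_atMost_Suc_shift) (simp del: fact_Suc power_Suc)
  finally have *: "(\<Sum>i=0..n. 2 ^ Suc i / fact (Suc i) * fps_nth ?F (n - i)) = 1 / fact n" .
  have "(\<Sum>i=0..n. of_nat (n choose i) * bernoulli (n - i) * 2 ^ i / of_nat (i + 1))
      = (\<Sum>i=0..n. fact n / 2 * (2 ^ Suc i / fact (Suc i) * fps_nth ?F (n - i)))"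
  proof (rule sum.cong)
    fix i assume "i \<in> {0..n}"
    then have "of_nat (n choose i) = (fact n / (fact i * fact (n - i)) :: rat)"
      by (simp add: binomial_fact)
    then show "of_nat (n choose i) * bernoulli (n - i) * 2 ^ i / of_nat (i + 1)
        = fact n / 2 * (2 ^ Suc i / fact (Suc i) * fps_nth ?F (n - i))"
      by (simp add: bernoulli_def mult.commute)
  qed simp
  also have "\<dots> = fact n / 2 * (1 / fact n)"
    by (subst * [symmetric]) (rule sum_distrib_left [symmetric])
  also have "\<dots> = 1 / 2"
    by simp
  finally show ?thesis
    by (simp add: sum.atLeast_Suc_atMost)
qed

section \<open>2-adic behaviour of Bernoulli numbers\<close>

text \<open>The prime 2 divides the denominator at most once. In the doubled recurrence the 2 goes
  to the earlier Bernoulli number, and \<open>2 ^ i\<close> handles \<open>i + 1\<close>.\<close>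

lemma two_bernoulli_two_integral: "2 * bernoulli n \<in> two_integral"
proof (induction n rule: less_induct)
  case (less n)
  show ?case
  proof (cases "n = 0")
    case True
    have "fps_nth (bernoulli_fps * (fps_exp 1 - 1)) 1 = (1 :: rat)"
      by (simp add: bernoulli_fps_mult)
    then have "bernoulli 0 = 1"
      by (simp add: fps_mult_nth bernoulli_def)
    then show ?thesis using True by simp
  next
    case False
    let ?t = "\<lambda>i. of_nat (n choose i) * bernoulli (n - i) * 2 ^ i / of_nat (i + 1) :: rat"
    have "2 * ?t i \<in> two_integral" if i: "i \<in> {1..n}" for i
    proof -
      have "i + 1 < 2 ^ Suc i"
        by (induction i) auto
      then have "2 ^ i / of_nat (i + 1) \<in> two_integral"
        by (intro two_power_divide_two_integral) auto
      moreover have "2 * bernoulli (n - i) \<in> two_integral"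
        using i less.IH by simp
      ultimately have "of_nat (n choose i) * ((2 * bernoulli (n - i)) * (2 ^ i / of_nat (i + 1)))
          \<in> two_integral"
        by (rule two_integral_mult[OF two_integral_of_nat two_integral_mult, rotated])
      then show ?thesis by (simp add: mult_ac)
    qed
    then have "1 - (\<Sum>i=1..n. 2 * ?t i) \<in> two_integral"
      by (intro two_integral_diff two_integral_sum) auto
    moreover have "bernoulli n = 1 / 2 - (\<Sum>i=1..n. ?t i)"
      using bernoulli_recurrence[of n] False by linarith
    then have "2 * bernoulli n = 1 - (\<Sum>i=1..n. 2 * ?t i)"
      by (simp add: sum_distrib_left right_diff_distrib)
    ultimately show ?thesis by simp
  qed
qed

text \<open>Only one of \<open>i\<close> and \<open>i + 1\<close> is even, so the whole power of 2
  can be spent on that one.\<close>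

lemma two_power_divide_consecutive_two_integral:
  assumes "i \<ge> 2"
  shows "2 ^ (i - 1) / (of_nat i * of_nat (i + 1)) \<in> two_integral"
proof -
  have "i + 1 < 2 ^ i" using assms
    by (induction i rule: nat_induct_at_least) auto
  then have bound: "i + 1 < 2 ^ Suc (i - 1)" using assms by simp
  show ?thesis
  proof (cases "even i")
    case True
    have "2 ^ (i - 1) / of_nat i \<in> two_integral"
      using assms bound by (intro two_power_divide_two_integral) auto
    moreover have "of_int 1 / of_int (int i + 1) \<in> two_integral"
      using True by (intro two_integralI) simp
    ultimately have "2 ^ (i - 1) / of_nat i * (of_int 1 / of_int (int i + 1)) \<in> two_integral"
      by (rule two_integral_mult)
    then show ?thesis by (simp add: add.commute)
  next
    case False
    have "2 ^ (i - 1) / of_nat (i + 1) \<in> two_integral"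
      using assms bound by (intro two_power_divide_two_integral) auto
    moreover have "of_int 1 / of_int (int i) \<in> two_integral"
      using False by (intro two_integralI) simp
    ultimately have "2 ^ (i - 1) / of_nat (i + 1) * (of_int 1 / of_int (int i)) \<in> two_integral"
      by (rule two_integral_mult)
    then show ?thesis by (simp add: mult.commute)
  qed
qed

text \<open>The case \<open>n = 2\<close> must be excluded: 1/6 = 1/2 + 2 * (-1/6), and -1/6 has an
  even denominator.\<close>

lemma bernoulli_cong_half:
  assumes "even n" and "n \<ge> 4"
  obtains u where "u \<in> two_integral" and "bernoulli n = 1 / 2 + of_nat n * u"
proof -
  let ?t = "\<lambda>i. of_nat (n choose i) * bernoulli (n - i) * 2 ^ i / of_nat (i + 1) :: rat"
  let ?s = "\<lambda>i. of_nat (n - 1 choose (i - 1)) *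
    (2 * bernoulli (n - i) * (2 ^ (i - 1) / (of_nat i * of_nat (i + 1)))) :: rat"
  \<comment> \<open>Here \<open>n - 1\<close> is odd and at least 3.\<close>
  have "?t 1 = 0"
    using assms bernoulli_odd[of "n - 1"] by simp
  then have "(\<Sum>i=1..n. ?t i) = (\<Sum>i=2..n. ?t i)"
    using assms sum.atLeast_Suc_atMost[of 1 n ?t] by (simp add: numeral_2_eq_2 del: of_nat_add)
  also have "\<dots> = (\<Sum>i=2..n. of_nat n * ?s i)"
  proof (rule sum.cong)
    fix i assume "i \<in> {2..n}"
    then have i: "i > 0" by simp
    then have "i * (n choose i) = n * (n - 1 choose (i - 1))"
      by (rule times_binomial_minus1_eq)
    then have "of_nat i * of_nat (n choose i) = (of_nat n * of_nat (n - 1 choose (i - 1)) :: rat)"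
      by (metis of_nat_mult)
    then have 1: "of_nat (n choose i) = (of_nat n * of_nat (n - 1 choose (i - 1)) / of_nat i :: rat)"
      using i by (simp add: field_simps)
    \<comment> \<open>One factor 2 is set aside to make \<open>bernoulli (n - i)\<close>
      2-integral.\<close>
    have 2: "(2::rat) ^ i = 2 * 2 ^ (i - 1)"
      using i by (cases i) auto
    show "?t i = of_nat n * ?s i"
      unfolding 1 2 by simp
  qed simp
  also have "\<dots> = of_nat n * (\<Sum>i=2..n. ?s i)"
    by (simp only: sum_distrib_left)
  finally have "bernoulli n = 1 / 2 + of_nat n * (- (\<Sum>i=2..n. ?s i))"
    using bernoulli_recurrence[of n] assms by simp
  moreover have "- (\<Sum>i=2..n. ?s i) \<in> two_integral"
    by (intro two_integral_minus two_integral_sum two_integral_mult two_integral_of_nat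
        two_bernoulli_two_integral two_power_divide_consecutive_two_integral) auto
  ultimately show thesis using that by blast
qed

theorem theoremA1:
  fixes k j c :: nat
  assumes "k > 0" and "even k"
    and "k = 2 ^ j * c" and "odd c" and "j \<ge> 1"
  shows "2 ^ (j + 3) dvd
    Num ((top_bernoulli (2 * k) - top_bernoulli k) / (top_bernoulli (2 * k) * top_bernoulli k))"
proof -
  have k2: "k \<ge> 2" using assms(1,2) by (elim evenE) auto
  obtain u where u: "u \<in> two_integral" "bernoulli (2 * k) = 1 / 2 + of_nat (2 * k) * u"
    using bernoulli_cong_half[of "2 * k"] k2 by auto
  obtain v where v: "v \<in> two_integral" "bernoulli (2 * (2 * k)) = 1 / 2 + of_nat (2 * (2 * k)) * v"
    using bernoulli_cong_half[of "2 * (2 * k)"] k2 by auto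
  define x where "x = of_nat (2 * k) * u"
  define y where "y = of_nat (2 * (2 * k)) * v"
  have xy: "x \<in> two_integral" "y \<in> two_integral"
    unfolding x_def y_def using u v by (auto intro!: two_integral_mult simp del: of_nat_mult)
  \<comment> \<open>The target quotient with \<open>2 ^ (j + 3)\<close> removed: 4 * (x - y) = 8 * k
    * (u - 2 * v), and k contributes \<open>2 ^ j * c\<close>.\<close>
  define z where
    "z = of_nat c * (u - 2 * v) * (inverse (1 + 2 * y) * inverse (1 + 2 * x))"
  have "z \<in> two_integral"
    unfolding z_def using u(1) v(1) two_integral_inverse_unit[OF xy(1)] two_integral_inverse_unit[OF xy(2)]
    by (intro two_integral_mult two_integral_diff) auto
  \<comment> \<open>Both \<open>k\<close> and \<open>2 * k\<close> are even, so both signs are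
    -1.\<close>
  have T: "top_bernoulli k = - (1 + 2 * x) / 2" "top_bernoulli (2 * k) = - (1 + 2 * y) / 2"
    using assms(2) u(2) v(2) by (simp_all add: top_bernoulli_def x_def y_def field_simps)
  have "top_bernoulli (2 * k) - top_bernoulli k = x - y"
    and "top_bernoulli (2 * k) * top_bernoulli k = (1 + 2 * y) * (1 + 2 * x) / 4"
    unfolding T by (simp_all add: field_simps)
  then have "(top_bernoulli (2 * k) - top_bernoulli k) / (top_bernoulli (2 * k) * top_bernoulli k)
      = (x - y) / ((1 + 2 * y) * (1 + 2 * x) / 4)"
    by (simp only:)
  also have "\<dots> = 4 * (x - y) * (inverse (1 + 2 * y) * inverse (1 + 2 * x))"
    by (simp only: divide_inverse inverse_mult_distrib inverse_inverse_eq mult_ac)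
  also have "4 * (x - y) = 2 ^ (j + 3) * (of_nat c * (u - 2 * v))"
    unfolding x_def y_def assms(3) by (simp add: power_add algebra_simps)
  also have "\<dots> * (inverse (1 + 2 * y) * inverse (1 + 2 * x)) = 2 ^ (j + 3) * z"
    unfolding z_def by (simp only: mult.assoc)
  finally show ?thesis
    using power_dvd_Num[OF \<open>z \<in> two_integral\<close>] by simp
qed

end
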